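(* For some $a>0$, let $g\colon(0,a)\to\mathbb R$ be a difference of two convex functions such that $$\int_{(0,u]}x\,|g''|(dx)<\infty$$ for some $u\in(0,a)$. Then there exists a finite limit $g(0):=\lim_{x\downarrow0}g(x)$, and $$\int_{(0,u]}x\,(g'(x))^2\,dx<\infty.$$
   Context: $g''(dx)$ is the locally finite signed measure on $(0,a)$ satisfying $g''((x,y])=g'_+(y)-g'_+(x)$, $0<x<y<a$, where $g'_+$ is the right derivative, and $|g''|(dx)$ is its variation measure. The derivative $g'$ exists except on an at most countable set, where it may be defined arbitrarily. *)

theory Defs
  imports "HOL-Analysis.Analysis"
begin

definition diff_convex_on :: "real set \<Rightarrow> (real \<Rightarrow> real) \<Rightarrow> bool" where
  "diff_convex_on S g \<longleftrightarrow>
     (\<exists>f h. convex_on S f \<and> convex_on S h \<and> (\<forall>x\<in>S. g x = f x - h x))"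

text \<open>A locally finite signed measure on an open set \<open>S\<close> (for instance \<open>dx / x - dx / (a - x)\<close> on
  \<open>(0, a)\<close>) need not have a value, finite or infinite, on every Borel subset of \<open>S\<close>. It is a
  countably additive real-valued function on the Borel sets contained in a compact subset of \<open>S\<close>.
  Outside these sets the function is required to be 0, so that two such measures which agree
  wherever they are defined are equal in HOL.\<close>

definition local_borel_sets :: "real set \<Rightarrow> real set set" where
  "local_borel_sets S = {A \<in> sets borel. \<exists>K. compact K \<and> K \<subseteq> S \<and> A \<subseteq> K}"

definition locally_finite_signed_measure :: "real set \<Rightarrow> (real set \<Rightarrow> real) \<Rightarrow> bool" where
  "locally_finite_signed_measure S \<nu> \<longleftrightarrow>
     (\<forall>A. A \<notin> local_borel_sets S \<longrightarrow> \<nu> A = 0) \<and>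
     (\<forall>A :: nat \<Rightarrow> real set.
        range A \<subseteq> local_borel_sets S \<longrightarrow> disjoint_family A \<longrightarrow> (\<Union>i. A i) \<in> local_borel_sets S \<longrightarrow>
        (\<lambda>i. \<nu> (A i)) sums \<nu> (\<Union>i. A i))"

text \<open>The families \<open>P\<close> below need not cover \<open>A\<close>. If \<open>\<nu>\<close> is defined on \<open>A\<close>, adding the set
  \<open>A - \<Union>P\<close> turns \<open>P\<close> into a finite partition of \<open>A\<close> without decreasing the sum, so this is the
  usual supremum over finite partitions; for other Borel sets \<open>A \<subseteq> S\<close> it is the supremum of the
  values on the subsets of \<open>A\<close> on which \<open>\<nu>\<close> is defined.\<close>

definition variation_measure :: "real set \<Rightarrow> (real set \<Rightarrow> real) \<Rightarrow> real measure" where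
  "variation_measure S \<nu> =
     measure_of S (sets (restrict_space borel S))
       (\<lambda>A. SUP P \<in> {P. finite P \<and> disjoint P \<and> P \<subseteq> local_borel_sets S \<and> \<Union>P \<subseteq> A}.
              \<Sum>B\<in>P. ennreal \<bar>\<nu> B\<bar>)"

definition right_deriv :: "(real \<Rightarrow> real) \<Rightarrow> real \<Rightarrow> real" where
  "right_deriv g x = vector_derivative g (at_right x)"

definition second_deriv_measure :: "real \<Rightarrow> (real \<Rightarrow> real) \<Rightarrow> real set \<Rightarrow> real" where
  "second_deriv_measure a g =
     (THE \<nu>. locally_finite_signed_measure {0<..<a} \<nu> \<and>
        (\<forall>x y. 0 < x \<longrightarrow> x < y \<longrightarrow> y < a \<longrightarrow> \<nu> {x<..y} = right_deriv g y - right_deriv g x))"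

end

theory Submission imports Defs begin

text \<open>Let \<open>D\<close> be the right derivative of \<open>g\<close>, \<open>V = |g''|\<close>, \<open>C\<close> the integral of \<open>x dV\<close> over \<open>(0, u]\<close>, and
  \<open>G x = V (x, u]\<close>. Then \<open>|D x| \<le> |D u| + G x\<close>. By Tonelli the integral of \<open>G\<close> over \<open>(0, u]\<close> is at most \<open>C\<close>,
  so \<open>D\<close> is integrable there and \<open>g x = g u - \<integral>\<^sub>x\<^sup>u D\<close> converges as \<open>x\<close> decreases to \<open>0\<close>. Moreover \<open>x * G x \<le> C\<close>, hence
  \<open>x * (D x)\<^sup>2 \<le> 2 * x * (D u)\<^sup>2 + 2 * C * G x\<close>, which is integrable; and \<open>g' = D\<close> off a countable set.

  Since \<open>g''\<close> is given by a definite description and \<open>|g''|\<close> by \<open>measure_of\<close>, both carry information only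
  after it is shown that the signed measure exists uniquely and that its variation is countably additive.\<close>

section \<open>Right derivatives of convex functions\<close>

lemma slope_commute:
  fixes f :: "real \<Rightarrow> real"
  shows "(f x - f y) / (x - y) = (f y - f x) / (y - x)"
  by (metis minus_diff_eq minus_divide_divide)

lemma convex_on_slope_mono:
  fixes f :: "real \<Rightarrow> real"
  assumes "convex_on I f" "x \<in> I" "z \<in> I" "x < y" "y < z"
  shows "(f y - f x) / (y - x) \<le> (f z - f x) / (z - x)"
    and "(f z - f x) / (z - x) \<le> (f z - f y) / (z - y)"
  using convex_on_slope_le[OF assms] by (metis slope_commute)+

lemma right_deriv_eqI:
  assumes "(f has_real_derivative D) (at_right x)"
  shows "right_deriv f x = D"
  using assms unfolding right_deriv_def has_real_derivative_iff_has_vector_derivative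
  by (intro vector_derivative_within) auto

text \<open>Chord slopes \<open>s y\<close> based at \<open>x\<close> increase with
  \<open>y\<close>, and every slope to the left bounds every slope to the right. So the right-hand
  limit exists as the infimum of the slopes on the right, and both inequalities are read off from
  this infimum.\<close>

lemma convex_on_right_deriv:
  fixes f :: "real \<Rightarrow> real"
  assumes f: "convex_on {a<..<b} f" and x: "x \<in> {a<..<b}"
  shows convex_on_has_right_deriv: "(f has_real_derivative right_deriv f x) (at_right x)"
    and right_deriv_le_slope: "\<And>y. \<lbrakk>x < y; y < b\<rbrakk> \<Longrightarrow> right_deriv f x \<le> (f y - f x) / (y - x)"
    and slope_le_right_deriv: "\<And>y. \<lbrakk>a < y; y < x\<rbrakk> \<Longrightarrow> (f x - f y) / (x - y) \<le> right_deriv f x"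
proof -
  define s where "s y = (f y - f x) / (y - x)" for y
  define D where "D = Inf (s ` ({x<..} \<inter> {a<..<b}))"
  have ne: "{x<..} \<inter> {a<..<b} \<noteq> {}"
    using dense[of x b] x by force
  have lower: "s y \<le> s z" if "a < y" "y < x" "x < z" "z < b" for y z
    using convex_on_slope_mono[OF f, of y z x] that x
    by (simp add: s_def slope_commute[of f y x])
  \<comment> \<open>The slope towards a point left of \<open>x\<close> is the lower bound that keeps
    the infimum meaningful.\<close>
  obtain w where w: "a < w" "w < x"
    using dense[of a x] x by auto
  have "(s \<longlongrightarrow> D) (at x within ({x<..} \<inter> {a<..<b}))"
    unfolding D_def
  proof (rule Lim_right_bound[where K = "s w"])
    show "s y \<le> s z" if "y \<in> {a<..<b}" "z \<in> {a<..<b}" "x < y" "y \<le> z" for y z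
      using convex_on_slope_mono(1)[OF f, of x z y] that x by (cases "y = z") (auto simp: s_def)
    show "s w \<le> s y" if "y \<in> {a<..<b}" "x < y" for y
      using lower[of w y] w that by auto
  qed
  also have "at x within ({x<..} \<inter> {a<..<b}) = at_right x"
    using x by (intro at_within_nhd[of _ "{a<..<b}"]) auto
  finally have D: "(f has_real_derivative D) (at_right x)"
    by (simp add: has_field_derivative_iff s_def [abs_def])
  then have eq: "right_deriv f x = D"
    by (rule right_deriv_eqI)
  show "(f has_real_derivative right_deriv f x) (at_right x)"
    using D eq by simp
  have bdd: "bdd_below (s ` ({x<..} \<inter> {a<..<b}))"
    using lower[OF w] by (intro bdd_belowI[of _ "s w"]) auto
  show "right_deriv f x \<le> (f y - f x) / (y - x)" if "x < y" "y < b" for y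
  proof -
    have "D \<le> s y"
      unfolding D_def using that x by (intro cInf_lower bdd) auto
    then show ?thesis
      by (simp add: eq s_def)
  qed
  show "(f x - f y) / (x - y) \<le> right_deriv f x" if "a < y" "y < x" for y
  proof -
    have "s y \<le> D"
      unfolding D_def using ne lower[OF that] by (intro cInf_greatest) auto
    then show ?thesis
      by (simp add: eq s_def slope_commute[of f x y])
  qed
qed

text \<open>The slope of the chord from \<open>x\<close> to \<open>y\<close> separates the two right
  derivatives.\<close>

lemma convex_on_right_deriv_mono:
  assumes f: "convex_on {a<..<b} f"
  shows "mono_on {a<..<b} (right_deriv f)"
proof (rule mono_onI)
  fix x y assume "x \<in> {a<..<b}" "y \<in> {a<..<b}" "x \<le> y"
  then show "right_deriv f x \<le> right_deriv f y"
    using right_deriv_le_slope[OF f, of x y] slope_le_right_deriv[OF f, of y x]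
    by (cases "x = y") auto
qed

text \<open>Monotonicity gives the lower half. For the upper half, fix \<open>z\<close> such that
  the slope from \<open>x\<close> to \<open>z\<close> is below \<open>e\<close>; by continuity of
  \<open>f\<close> the slope from \<open>y\<close> to \<open>z\<close> stays below \<open>e\<close>
  for \<open>y\<close> near \<open>x\<close>, and it dominates the right derivative at
  \<open>y\<close>.\<close>

lemma convex_on_right_deriv_right_continuous:
  assumes f: "convex_on {a<..<b} f" and x: "x \<in> {a<..<b}"
  shows "continuous (at_right x) (right_deriv f)"
proof -
  have near: "\<forall>\<^sub>F y in at_right x. x < y \<and> y < z" if "x < z" for z
    using that by (auto simp: eventually_at_right)
  show ?thesis
    unfolding continuous_within
  proof (rule order_tendstoI)
    fix e assume e: "e < right_deriv f x"
    have "x < b" using x by simp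
    from near[OF this] show "\<forall>\<^sub>F y in at_right x. e < right_deriv f y"
    proof eventually_elim
      case (elim y)
      then have "right_deriv f x \<le> right_deriv f y"
        using x by (intro mono_onD[OF convex_on_right_deriv_mono[OF f]]) auto
      with e show ?case by simp
    qed
  next
    fix e assume e: "right_deriv f x < e"
    have "((\<lambda>z. (f z - f x) / (z - x)) \<longlongrightarrow> right_deriv f x) (at_right x)"
      using convex_on_has_right_deriv[OF f x] by (simp add: has_field_derivative_iff)
    then have "\<forall>\<^sub>F z in at_right x. (f z - f x) / (z - x) < e"
      using e by (rule order_tendstoD)
    moreover have "\<forall>\<^sub>F z in at_right x. x < z \<and> z < b"
      using x by (intro near) auto
    ultimately have "\<forall>\<^sub>F z in at_right x. (f z - f x) / (z - x) < e \<and> x < z \<and> z < b"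
      by eventually_elim auto
    then obtain z where z: "(f z - f x) / (z - x) < e" "x < z" "z < b"
      using eventually_happens[of _ "at_right x"] by auto
    have "isCont f x"
      using convex_on_continuous[OF _ f] x by (simp add: continuous_on_eq_continuous_at)
    then have "isCont (\<lambda>y. (f z - f y) / (z - y)) x"
      using z by (intro continuous_intros) auto
    then have "((\<lambda>y. (f z - f y) / (z - y)) \<longlongrightarrow> (f z - f x) / (z - x)) (at_right x)"
      unfolding isCont_def by (rule filterlim_mono) (auto intro: at_le)
    then have "\<forall>\<^sub>F y in at_right x. (f z - f y) / (z - y) < e"
      using z(1) by (rule order_tendstoD)
    with near[OF z(2)] show "\<forall>\<^sub>F y in at_right x. right_deriv f y < e"
    proof eventually_elim
      case (elim y)
      with right_deriv_le_slope[OF f, of y z] x z show ?case by auto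
    qed
  qed
qed

text \<open>Slopes from \<open>y < x\<close> to \<open>x\<close> lie between the right derivatives
  at \<open>y\<close> and at \<open>x\<close>, so continuity of the right derivative squeezes the
  left-hand limit.\<close>

lemma convex_on_has_real_derivative:
  assumes f: "convex_on {a<..<b} f" and x: "x \<in> {a<..<b}"
    and cont: "isCont (right_deriv f) x"
  shows "(f has_real_derivative right_deriv f x) (at x)"
proof -
  have "((\<lambda>y. (f y - f x) / (y - x)) \<longlongrightarrow> right_deriv f x) (at_left x)"
  proof (rule tendsto_sandwich)
    have near: "\<forall>\<^sub>F y in at_left x. a < y \<and> y < x"
      using x by (auto simp: eventually_at_left)
    show "\<forall>\<^sub>F y in at_left x. right_deriv f y \<le> (f y - f x) / (y - x)"
      using near
    proof eventually_elim
      case (elim y)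
      with right_deriv_le_slope[OF f, of y x] x show ?case
        by (simp add: slope_commute[of f y x])
    qed
    show "\<forall>\<^sub>F y in at_left x. (f y - f x) / (y - x) \<le> right_deriv f x"
      using near
    proof eventually_elim
      case (elim y)
      with slope_le_right_deriv[OF f, of x y] x show ?case
        by (simp add: slope_commute[of f y x])
    qed
    show "(right_deriv f \<longlongrightarrow> right_deriv f x) (at_left x)"
      using cont unfolding isCont_def by (rule filterlim_mono) (auto intro: at_le)
  qed auto
  moreover have "((\<lambda>y. (f y - f x) / (y - x)) \<longlongrightarrow> right_deriv f x) (at_right x)"
    using convex_on_has_right_deriv[OF f x] by (simp add: has_field_derivative_iff)
  ultimately show ?thesis
    by (simp add: has_field_derivative_iff filterlim_at_split)
qed

text \<open>Both the increment of \<open>f\<close> and the integral of its right derivative \<open>D\<close> over \<open>[s, t]\<close> lie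
  between \<open>D s * (t - s)\<close> and \<open>D t * (t - s)\<close>, and summing the resulting error bounds over \<open>n\<close> equal
  subintervals telescopes.\<close>

lemma convex_on_right_deriv_has_integral:
  assumes f: "convex_on {a<..<b} f" and xy: "a < x" "x \<le> y" "y < b"
  shows "(right_deriv f has_integral f y - f x) {x..y}"
proof -
  let ?D = "right_deriv f"
  have int: "?D integrable_on {s..t}" if "a < s" "t < b" for s t
    using that by (intro integrable_on_mono_on mono_on_subset[OF convex_on_right_deriv_mono[OF f]]) auto
  define E where "E s t = f t - f s - integral {s..t} ?D" for s t
  have E_bound: "\<bar>E s t\<bar> \<le> (?D t - ?D s) * (t - s)" if st: "a < s" "s \<le> t" "t < b" for s t
  proof (cases "s = t")
    case False
    have mono: "?D s \<le> ?D r" "?D r \<le> ?D t" if "r \<in> {s..t}" for r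
      using that st by (auto intro!: mono_onD[OF convex_on_right_deriv_mono[OF f]])
    have "?D s * (t - s) \<le> integral {s..t} ?D" "integral {s..t} ?D \<le> ?D t * (t - s)"
      using integral_le[OF _ int[of s t], of "\<lambda>_. ?D s"] integral_le[OF int[of s t], of "\<lambda>_. ?D t"]
        mono st by (auto simp: mult.commute)
    moreover have "?D s * (t - s) \<le> f t - f s" "f t - f s \<le> ?D t * (t - s)"
      using right_deriv_le_slope[OF f, of s t] slope_le_right_deriv[OF f, of t s] st False
      by (auto simp: field_simps)
    ultimately show ?thesis
      by (simp add: E_def algebra_simps)
  qed (simp add: E_def)
  have "\<bar>E x y\<bar> \<le> (?D y - ?D x) * (y - x) / Suc n" for n
  proof -
    define h where "h = (y - x) / Suc n"
    define t where "t k = x + real k * h" for k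
    have h: "0 \<le> h" and tn: "t (Suc n) = y"
      using xy by (auto simp: h_def t_def field_simps simp del: of_nat_Suc)
    have t_mono: "t j \<le> t k" if "j \<le> k" for j k
      using h that by (auto simp: t_def intro!: mult_right_mono)
    have t_bounds: "x \<le> t k" "t k \<le> y" if "k \<le> Suc n" for k
      using t_mono[of 0 k] t_mono[OF that] tn by (auto simp: t_def)
    have "\<bar>E x (t k)\<bar> \<le> (?D (t k) - ?D x) * h" if "k \<le> Suc n" for k
      using that
    proof (induction k)
      case 0
      then show ?case by (simp add: E_def t_def)
    next
      case (Suc k)
      have *: "a < t k" "t k \<le> t (Suc k)" "t (Suc k) < b" "x \<le> t k"
        using t_bounds[of k] t_bounds[of "Suc k"] t_mono[of k "Suc k"] xy Suc.prems by auto
      have "integral {x..t k} ?D + integral {t k..t (Suc k)} ?D = integral {x..t (Suc k)} ?D"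
        using * xy by (intro Henstock_Kurzweil_Integration.integral_combine int) auto
      then have "E x (t (Suc k)) = E x (t k) + E (t k) (t (Suc k))"
        by (simp add: E_def)
      moreover have "t (Suc k) - t k = h"
        by (simp add: t_def algebra_simps)
      ultimately show ?case
        using Suc E_bound[OF *(1-3)] by (simp add: algebra_simps)
    qed
    from this[of "Suc n"] show ?thesis
      by (simp add: tn h_def)
  qed
  \<comment> \<open>The error \<open>E x y\<close> does not depend on \<open>n\<close>, while its
    bound tends to 0.\<close>
  moreover have "(\<lambda>n. (?D y - ?D x) * (y - x) / real (Suc n)) \<longlonglongrightarrow> 0"
    by (rule LIMSEQ_Suc) (rule lim_const_over_n)
  ultimately have "\<bar>E x y\<bar> \<le> 0"
    by (intro LIMSEQ_le_const) auto
  then have "integral {x..y} ?D = f y - f x"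
    by (simp add: E_def)
  then show ?thesis
    using int[of x y] xy by (metis has_integral_iff)
qed

section \<open>Locally finite signed measures\<close>

text \<open>Half-open intervals replace compact sets because the signed measure is prescribed on
  them. The left end is taken strictly below the minimum of the compact set, since it is excluded
  from the interval; the maximum can serve as right end.\<close>

lemma local_borel_sets_iff:
  assumes "a < b"
  shows "A \<in> local_borel_sets {a<..<b} \<longleftrightarrow>
    A \<in> sets borel \<and> (\<exists>x y. a < x \<and> x < y \<and> y < b \<and> A \<subseteq> {x<..y})"
proof (intro iffI)
  assume "A \<in> local_borel_sets {a<..<b}"
  then obtain K where K: "A \<in> sets borel" "compact K" "K \<subseteq> {a<..<b}" "A \<subseteq> K"
    by (auto simp: local_borel_sets_def)
  have "\<exists>x y. a < x \<and> x < y \<and> y < b \<and> K \<subseteq> {x<..y}"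
  proof (cases "K = {}")
    case True
    obtain x where "a < x" "x < b" using dense[OF assms] by auto
    moreover obtain y where "x < y" "y < b" using dense[OF \<open>x < b\<close>] by auto
    ultimately show ?thesis using True by blast
  next
    case False
    obtain m where m: "m \<in> K" "\<forall>t\<in>K. m \<le> t"
      using compact_attains_inf[OF K(2) False] by auto
    obtain y where y: "y \<in> K" "\<forall>t\<in>K. t \<le> y"
      using compact_attains_sup[OF K(2) False] by auto
    have "a < m" using m K by auto
    then obtain x where "a < x" "x < m" using dense by blast
    then have "a < x \<and> x < y \<and> y < b \<and> K \<subseteq> {x<..y}"
      using m y K by force
    then show ?thesis by blast
  qed
  with K show "A \<in> sets borel \<and> (\<exists>x y. a < x \<and> x < y \<and> y < b \<and> A \<subseteq> {x<..y})"
    by blast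
next
  assume "A \<in> sets borel \<and> (\<exists>x y. a < x \<and> x < y \<and> y < b \<and> A \<subseteq> {x<..y})"
  then obtain x y where *: "A \<in> sets borel" "a < x" "x < y" "y < b" "A \<subseteq> {x<..y}"
    by blast
  moreover have "{x<..y} \<subseteq> {x..y}" "{x..y} \<subseteq> {a<..<b}"
    using * by auto
  ultimately show "A \<in> local_borel_sets {a<..<b}"
    unfolding local_borel_sets_def by (blast intro: compact_Icc)
qed

lemma local_borel_sets_borel: "A \<in> local_borel_sets S \<Longrightarrow> A \<in> sets borel"
  and local_borel_sets_subset: "A \<in> local_borel_sets S \<Longrightarrow> A \<subseteq> S"
  and local_borel_sets_mono:
    "\<lbrakk>A \<in> local_borel_sets S; B \<in> sets borel; B \<subseteq> A\<rbrakk> \<Longrightarrow> B \<in> local_borel_sets S"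
  and empty_local_borel_sets [simp]: "{} \<in> local_borel_sets S"
  by (auto simp: local_borel_sets_def)

lemma lfsm_sums:
  assumes "locally_finite_signed_measure S \<nu>"
    and "range A \<subseteq> local_borel_sets S" "disjoint_family A" "(\<Union>i. A i) \<in> local_borel_sets S"
  shows "(\<lambda>i. \<nu> (A i)) sums \<nu> (\<Union>i. A i)"
  using assms by (simp add: locally_finite_signed_measure_def)

text \<open>The empty set repeated is a disjoint family, and a constant series converges only if its
  terms vanish.\<close>

lemma lfsm_empty [simp]:
  assumes "locally_finite_signed_measure S \<nu>"
  shows "\<nu> {} = 0"
proof -
  have "(\<lambda>i::nat. \<nu> {}) sums \<nu> {}"
    using lfsm_sums[OF assms, of "\<lambda>_. {}"] by (simp add: disjoint_family_on_def)
  then have "(\<lambda>i::nat. \<nu> {}) \<longlonglongrightarrow> 0"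
    by (intro summable_LIMSEQ_zero sums_summable)
  then show ?thesis
    by (simp add: LIMSEQ_const_iff)
qed

lemma lfsm_Un:
  assumes \<nu>: "locally_finite_signed_measure S \<nu>"
    and AB: "A \<union> B \<in> local_borel_sets S" "A \<in> sets borel" "B \<in> sets borel" "A \<inter> B = {}"
  shows "\<nu> (A \<union> B) = \<nu> A + \<nu> B"
proof -
  have "range (binaryset A B) \<subseteq> local_borel_sets S"
    using AB by (auto simp: range_binaryset_eq intro: local_borel_sets_mono)
  then have "(\<lambda>i. \<nu> (binaryset A B i)) sums \<nu> (A \<union> B)"
    using lfsm_sums[OF \<nu>, of "binaryset A B"] AB
    by (simp add: UN_binaryset_eq disjoint_family_on_def binaryset_def Int_commute)
  moreover have "(\<lambda>i. \<nu> (binaryset A B i)) sums (\<nu> A + \<nu> B)"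
    using \<nu> by (intro binaryset_sums) simp
  ultimately show ?thesis
    using sums_unique2 by blast
qed

lemma lfsm_diff:
  assumes "locally_finite_signed_measure S \<mu>" "locally_finite_signed_measure S \<nu>"
  shows "locally_finite_signed_measure S (\<lambda>A. \<mu> A - \<nu> A)"
  using assms unfolding locally_finite_signed_measure_def by (auto intro: sums_diff)

text \<open>Dynkin's argument inside one interval \<open>{x<..y}\<close> containing
  \<open>A\<close>: all traces of Borel sets on it lie in the domain of both measures, and the sets
  with equal traces contain the intersection-stable generator of half-lines.\<close>

lemma lfsm_eqI:
  assumes \<mu>: "locally_finite_signed_measure {a<..<b} \<mu>"
    and \<nu>: "locally_finite_signed_measure {a<..<b} \<nu>"
    and eq: "\<And>x y. \<lbrakk>a < x; x < y; y < b\<rbrakk> \<Longrightarrow> \<mu> {x<..y} = \<nu> {x<..y}"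
  shows "\<mu> = \<nu>"
proof
  fix A
  show "\<mu> A = \<nu> A"
  proof (cases "A \<in> local_borel_sets {a<..<b}")
    case False
    then show ?thesis
      using \<mu> \<nu> by (simp add: locally_finite_signed_measure_def)
  next
    case True
    \<comment> \<open>If \<open>a < b\<close> fails, the interval is empty and so is
      \<open>A\<close>.\<close>
    then have "a < b \<or> A = {}"
      using local_borel_sets_subset by fastforce
    then show ?thesis
    proof
      assume "a < b"
      with True obtain x y where xy: "a < x" "x < y" "y < b" "A \<subseteq> {x<..y}" and A: "A \<in> sets borel"
        by (auto simp: local_borel_sets_iff)
      have loc: "B \<inter> {x<..y} \<in> local_borel_sets {a<..<b}" if "B \<in> sets borel" for B
        using that xy \<open>a < b\<close> by (auto simp: local_borel_sets_iff)
      have borel: "sets borel = sigma_sets UNIV (range (\<lambda>t::real. {..t}))"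
        by (subst borel_eq_atMost) simp
      have "Int_stable (range (\<lambda>t::real. {..t}))"
        by (auto simp: Int_stable_def)
      moreover have "range (\<lambda>t::real. {..t}) \<subseteq> Pow UNIV" by simp
      moreover note A[unfolded borel]
      ultimately have "\<mu> (A \<inter> {x<..y}) = \<nu> (A \<inter> {x<..y})"
      proof (induction rule: sigma_sets_induct_disjoint)
        case (basic B)
        \<comment> \<open>For \<open>t \<le> x\<close> this interval is empty and both values are
          0.\<close>
        then obtain t where "B \<inter> {x<..y} = {x<..min t y}"
          by (auto simp: set_eq_iff)
        then show ?case
          using eq[of x "min t y"] xy \<mu> \<nu> by (cases "x < min t y") auto
      next
        case empty
        then show ?case using \<mu> \<nu> by simp
      next
        case (compl B)
        then have B: "B \<in> sets borel" by (simp add: borel)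
        have U: "(B \<inter> {x<..y}) \<union> ((UNIV - B) \<inter> {x<..y}) = {x<..y}"
          by auto
        have "{x<..y} \<in> local_borel_sets {a<..<b}"
          using loc[of UNIV] by simp
        then have "\<rho> {x<..y} = \<rho> (B \<inter> {x<..y}) + \<rho> ((UNIV - B) \<inter> {x<..y})"
          if "locally_finite_signed_measure {a<..<b} \<rho>" for \<rho>
          using lfsm_Un[OF that, of "B \<inter> {x<..y}" "(UNIV - B) \<inter> {x<..y}", unfolded U] B by auto
        \<comment> \<open>All values are real, so the value on the complement is obtained by
          subtraction.\<close>
        from this[OF \<mu>] this[OF \<nu>] compl.IH eq[of x y] xy show ?case
          by simp
      next
        case (union B)
        then have B: "B i \<in> sets borel" for i by (auto simp: borel)
        have U: "(\<Union>i. B i) \<inter> {x<..y} = (\<Union>i. B i \<inter> {x<..y})"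
          by blast
        have "(\<lambda>i. \<rho> (B i \<inter> {x<..y})) sums \<rho> (\<Union>i. B i \<inter> {x<..y})"
          if "locally_finite_signed_measure {a<..<b} \<rho>" for \<rho>
        proof (rule lfsm_sums[OF that])
          show "range (\<lambda>i. B i \<inter> {x<..y}) \<subseteq> local_borel_sets {a<..<b}"
            using loc B by auto
          show "disjoint_family (\<lambda>i. B i \<inter> {x<..y})"
            using union by (auto simp: disjoint_family_on_def)
          show "(\<Union>i. B i \<inter> {x<..y}) \<in> local_borel_sets {a<..<b}"
            using loc[of "\<Union>i. B i"] B unfolding U by blast
        qed
        from this[OF \<mu>] this[OF \<nu>] show ?case
          unfolding U union.IH by (rule sums_unique2)
      qed
      then show ?thesis
        using xy by (simp add: Int_absorb2)
    qed (use \<mu> \<nu> in simp)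
  qed
qed

text \<open>A homeomorphism from the line onto \<open>(a, b)\<close> turns \<open>F\<close> into a distribution function on the whole
  line, although \<open>F\<close> may be unbounded at both ends.\<close>

lemma mono_on_lfsm_exists:
  fixes F :: "real \<Rightarrow> real"
  assumes ab: "a < b" and mono: "mono_on {a<..<b} F"
    and right_cont: "\<And>x. x \<in> {a<..<b} \<Longrightarrow> continuous (at_right x) F"
  obtains \<nu> where "locally_finite_signed_measure {a<..<b} \<nu>"
    and "\<And>x y. \<lbrakk>a < x; x < y; y < b\<rbrakk> \<Longrightarrow> \<nu> {x<..y} = F y - F x"
proof -
  \<comment> \<open>\<open>\<phi>\<close> is the logistic curve rescaled to \<open>(a, b)\<close>,
    and \<open>\<psi>\<close> is its inverse, found by solving for \<open>t\<close>.\<close>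
  define \<phi> where "\<phi> t = a + (b - a) / (1 + exp (- t))" for t
  define \<psi> where "\<psi> x = - ln ((b - a) / (x - a) - 1)" for x
  have pos: "0 < 1 + exp (- t)" for t :: real
    by (simp add: add_pos_pos)
  have \<phi>_in: "\<phi> t \<in> {a<..<b}" for t
  proof -
    have "(b - a) * 1 < (b - a) * (1 + exp (- t))"
      using ab by (intro mult_strict_left_mono) auto
    then have "(b - a) / (1 + exp (- t)) < b - a"
      using pos[of t] by (simp add: pos_divide_less_eq)
    with ab pos[of t] show ?thesis by (simp add: \<phi>_def)
  qed
  have \<phi>_strict_mono: "\<phi> s < \<phi> t" if "s < t" for s t
    using ab that pos by (auto simp: \<phi>_def intro!: divide_strict_left_mono mult_pos_pos)
  have \<phi>_\<psi>: "\<phi> (\<psi> x) = x" if "x \<in> {a<..<b}" for x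
  proof -
    have "0 < (b - a) / (x - a) - 1"
      using that by (simp add: field_simps)
    then show ?thesis
      using that by (simp add: \<phi>_def \<psi>_def)
  qed
  have \<phi>_cont: "isCont \<phi> t" for t
    unfolding \<phi>_def using pos[of t] by (intro continuous_intros) auto
  have \<phi>_measurable [measurable]: "\<phi> \<in> borel_measurable borel"
    by (intro borel_measurable_continuous_onI continuous_at_imp_continuous_on) (simp add: \<phi>_cont)
  have mono': "F (\<phi> s) \<le> F (\<phi> t)" if "s \<le> t" for s t
    using that \<phi>_in \<phi>_strict_mono[of s t] by (intro mono_onD[OF mono]) (auto simp: le_less)
  have right_cont': "continuous (at_right t) (\<lambda>t. F (\<phi> t))" for t
  proof -
    \<comment> \<open>Right continuity of \<open>F\<close> applies only if \<open>\<phi>\<close>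
      approaches \<open>\<phi> t\<close> strictly from the right, which strict monotonicity
      ensures.\<close>
    have "filterlim \<phi> (at_right (\<phi> t)) (at_right t)"
      unfolding filterlim_at
    proof
      show "\<forall>\<^sub>F s in at_right t. \<phi> s \<in> {\<phi> t<..} \<and> \<phi> s \<noteq> \<phi> t"
        using \<phi>_strict_mono by (intro eventually_at_right_less[THEN eventually_mono]) force
      show "(\<phi> \<longlongrightarrow> \<phi> t) (at_right t)"
        using \<phi>_cont[of t] unfolding isCont_def by (rule filterlim_mono) (auto intro: at_le)
    qed
    moreover have "(F \<longlongrightarrow> F (\<phi> t)) (at_right (\<phi> t))"
      using right_cont[OF \<phi>_in] by (simp add: continuous_within)
    ultimately show ?thesis
      unfolding continuous_within by (rule filterlim_compose[rotated])
  qed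
  \<comment> \<open>The Stieltjes measure of \<open>F\<close> composed with \<open>\<phi>\<close>,
    transported back to \<open>(a, b)\<close>; its total mass may be infinite.\<close>
  define M where "M = distr (interval_measure (\<lambda>t. F (\<phi> t))) borel \<phi>"
  have M_Ioc: "emeasure M {x<..y} = ennreal (F y - F x)" if xy: "a < x" "x \<le> y" "y < b" for x y
  proof -
    have less_iff: "\<phi> s < \<phi> t \<longleftrightarrow> s < t" for s t
      using \<phi>_strict_mono[of s t] \<phi>_strict_mono[of t s] by (cases s t rule: linorder_cases) auto
    have "\<phi> -` {\<phi> s<..\<phi> t} = {s<..t}" for s t
      by (auto simp: less_iff simp flip: not_less)
    from this[of "\<psi> x" "\<psi> y"] have "\<phi> -` {x<..y} = {\<psi> x<..\<psi> y}"
      using \<phi>_\<psi> xy by simp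
    moreover have "\<psi> x \<le> \<psi> y"
      using less_iff[of "\<psi> y" "\<psi> x"] \<phi>_\<psi> xy by simp
    ultimately show ?thesis
      using mono' right_cont' \<phi>_\<psi> xy
      by (simp add: M_def emeasure_distr emeasure_interval_measure_Ioc)
  qed
  \<comment> \<open>The value 0 outside the local sets is imposed by the definition of a locally
    finite signed measure.\<close>
  define \<nu> where "\<nu> A = (if A \<in> local_borel_sets {a<..<b} then measure M A else 0)" for A
  show ?thesis
  proof
    show "\<nu> {x<..y} = F y - F x" if xy: "a < x" "x < y" "y < b" for x y
    proof -
      have "{x<..y} \<in> local_borel_sets {a<..<b}"
        using xy ab by (auto simp: local_borel_sets_iff)
      moreover have "F x \<le> F y"
        using xy by (intro mono_onD[OF mono]) auto
      ultimately show ?thesis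
        using M_Ioc[of x y] xy by (simp add: \<nu>_def measure_def)
    qed
    show "locally_finite_signed_measure {a<..<b} \<nu>"
      unfolding locally_finite_signed_measure_def
    proof (intro conjI allI impI)
      fix A :: "nat \<Rightarrow> real set"
      assume A: "range A \<subseteq> local_borel_sets {a<..<b}" "disjoint_family A"
        "(\<Union>i. A i) \<in> local_borel_sets {a<..<b}"
      obtain x y where xy: "a < x" "x < y" "y < b" "(\<Union>i. A i) \<subseteq> {x<..y}"
        using A(3) ab by (auto simp: local_borel_sets_iff)
      \<comment> \<open>Additivity of the real-valued \<open>measure\<close> requires finite mass of
        the union, which the enclosing interval provides.\<close>
      have "emeasure M (\<Union>i. A i) \<le> emeasure M {x<..y}"
        using xy by (intro emeasure_mono) (auto simp: M_def)
      also have "\<dots> < \<infinity>"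
        using M_Ioc[of x y] xy by simp
      finally have "(\<lambda>i. measure M (A i)) sums measure M (\<Union>i. A i)"
        using A local_borel_sets_borel by (intro measure_UNION) (auto simp: M_def)
      then show "(\<lambda>i. \<nu> (A i)) sums \<nu> (\<Union>i. A i)"
        using A by (simp add: \<nu>_def range_subsetD)
    qed (simp add: \<nu>_def)
  qed
qed

section \<open>Differences of convex functions and their second derivative measure\<close>

lemma diff_convex_onE:
  assumes g: "diff_convex_on {a<..<b} g"
  obtains f h where "convex_on {a<..<b} f" "convex_on {a<..<b} h"
    and "\<And>x. x \<in> {a<..<b} \<Longrightarrow> g x = f x - h x"
    and "\<And>x. x \<in> {a<..<b} \<Longrightarrow> right_deriv g x = right_deriv f x - right_deriv h x"
proof -
  obtain f h where f: "convex_on {a<..<b} f" and h: "convex_on {a<..<b} h"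
    and eq: "\<And>x. x \<in> {a<..<b} \<Longrightarrow> g x = f x - h x"
    using g by (auto simp: diff_convex_on_def)
  have "right_deriv g x = right_deriv f x - right_deriv h x" if x: "x \<in> {a<..<b}" for x
  proof (rule right_deriv_eqI)
    have "((\<lambda>x. f x - h x) has_real_derivative right_deriv f x - right_deriv h x) (at_right x)"
      by (intro derivative_intros convex_on_has_right_deriv[OF f x] convex_on_has_right_deriv[OF h x])
    \<comment> \<open>The equality \<open>g = f - h\<close> is known only on \<open>(a, b)\<close>,
      which contains a right neighbourhood of \<open>x\<close>.\<close>
    moreover have "\<forall>\<^sub>F y in at_right x. f y - h y = g y"
      using x by (intro eventually_at_rightI[of x b]) (auto simp: eq)
    ultimately show "(g has_real_derivative right_deriv f x - right_deriv h x) (at_right x)"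
      using has_field_derivative_cong_eventually[of "\<lambda>x. f x - h x" g x] eq[OF x] by auto
  qed
  with f h eq that show thesis by blast
qed

text \<open>Unfolds the definite description: subtracting the measures of the two convex parts gives
  existence, and \<open>lfsm_eqI\<close> gives uniqueness.\<close>

lemma second_deriv_measure:
  assumes a: "0 < a" and g: "diff_convex_on {0<..<a} g"
  shows "locally_finite_signed_measure {0<..<a} (second_deriv_measure a g)"
    and "\<And>x y. \<lbrakk>0 < x; x < y; y < a\<rbrakk> \<Longrightarrow>
      second_deriv_measure a g {x<..y} = right_deriv g y - right_deriv g x"
proof -
  let ?P = "\<lambda>\<nu>. locally_finite_signed_measure {0<..<a} \<nu> \<and>
    (\<forall>x y. 0 < x \<longrightarrow> x < y \<longrightarrow> y < a \<longrightarrow> \<nu> {x<..y} = right_deriv g y - right_deriv g x)"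
  obtain f h where f: "convex_on {0<..<a} f" and h: "convex_on {0<..<a} h"
    and eq: "\<And>x. x \<in> {0<..<a} \<Longrightarrow> right_deriv g x = right_deriv f x - right_deriv h x"
    by (rule diff_convex_onE[OF g]) (rule that)
  obtain \<mu> where \<mu>: "locally_finite_signed_measure {0<..<a} \<mu>"
      "\<And>x y. \<lbrakk>0 < x; x < y; y < a\<rbrakk> \<Longrightarrow> \<mu> {x<..y} = right_deriv f y - right_deriv f x"
    by (rule mono_on_lfsm_exists[OF a convex_on_right_deriv_mono[OF f]
          convex_on_right_deriv_right_continuous[OF f]]) (assumption | rule that)+
  obtain \<nu> where \<nu>: "locally_finite_signed_measure {0<..<a} \<nu>"
      "\<And>x y. \<lbrakk>0 < x; x < y; y < a\<rbrakk> \<Longrightarrow> \<nu> {x<..y} = right_deriv h y - right_deriv h x"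
    by (rule mono_on_lfsm_exists[OF a convex_on_right_deriv_mono[OF h]
          convex_on_right_deriv_right_continuous[OF h]]) (assumption | rule that)+
  have ex: "?P (\<lambda>A. \<mu> A - \<nu> A)"
    using lfsm_diff[OF \<mu>(1) \<nu>(1)] by (simp add: \<mu>(2) \<nu>(2) eq)
  have unique: "\<rho> = \<sigma>" if "?P \<rho>" "?P \<sigma>" for \<rho> \<sigma>
    using that by (intro lfsm_eqI[of 0 a]) auto
  have "?P (THE \<nu>. ?P \<nu>)"
    using ex by (rule theI[of ?P]) (rule unique[OF _ ex])
  then have "?P (second_deriv_measure a g)"
    unfolding second_deriv_measure_def .
  then show "locally_finite_signed_measure {0<..<a} (second_deriv_measure a g)"
    and "\<And>x y. \<lbrakk>0 < x; x < y; y < a\<rbrakk> \<Longrightarrow>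
      second_deriv_measure a g {x<..y} = right_deriv g y - right_deriv g x"
    by blast+
qed

section \<open>The variation measure\<close>

text \<open>The triangle inequality for partial sums passes to the limit. In \<open>ennreal\<close>
  the series of absolute values always has a value.\<close>

lemma lfsm_abs_le_suminf:
  assumes \<nu>: "locally_finite_signed_measure S \<nu>"
    and A: "range A \<subseteq> local_borel_sets S" "disjoint_family A" "(\<Union>i. A i) \<in> local_borel_sets S"
  shows "ennreal \<bar>\<nu> (\<Union>i. A i)\<bar> \<le> (\<Sum>i. ennreal \<bar>\<nu> (A i)\<bar>)"
proof -
  have "(\<lambda>n. \<Sum>i<n. \<nu> (A i)) \<longlonglongrightarrow> \<nu> (\<Union>i. A i)"
    using lfsm_sums[OF \<nu> A] by (simp add: sums_def)
  then have "(\<lambda>n. ennreal \<bar>\<Sum>i<n. \<nu> (A i)\<bar>) \<longlonglongrightarrow> ennreal \<bar>\<nu> (\<Union>i. A i)\<bar>"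
    by (intro tendsto_ennrealI tendsto_rabs)
  moreover have "ennreal \<bar>\<Sum>i<n. \<nu> (A i)\<bar> \<le> (\<Sum>i. ennreal \<bar>\<nu> (A i)\<bar>)" for n
  proof -
    have "ennreal \<bar>\<Sum>i<n. \<nu> (A i)\<bar> \<le> ennreal (\<Sum>i<n. \<bar>\<nu> (A i)\<bar>)"
      by (intro ennreal_leI sum_abs)
    also have "\<dots> = (\<Sum>i<n. ennreal \<bar>\<nu> (A i)\<bar>)"
      by (simp add: sum_ennreal)
    also have "\<dots> \<le> (\<Sum>i. ennreal \<bar>\<nu> (A i)\<bar>)"
      by (intro sum_le_suminf) auto
    finally show ?thesis .
  qed
  ultimately show ?thesis
    by (intro LIMSEQ_le_const2[where X = "\<lambda>n. ennreal \<bar>\<Sum>i<n. \<nu> (A i)\<bar>"]) blast+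
qed

text \<open>The index set of the supremum in \<open>variation_measure\<close>.\<close>

definition disjoint_packings :: "real set \<Rightarrow> real set \<Rightarrow> real set set set" where
  "disjoint_packings S A = {P. finite P \<and> disjoint P \<and> P \<subseteq> local_borel_sets S \<and> \<Union>P \<subseteq> A}"

text \<open>The set function passed to \<open>measure_of\<close> in
  \<open>variation_measure\<close>, isolated so that its countable additivity can be proved
  first.\<close>

definition total_variation :: "real set \<Rightarrow> (real set \<Rightarrow> real) \<Rightarrow> real set \<Rightarrow> ennreal" where
  "total_variation S \<nu> A = (SUP P \<in> disjoint_packings S A. \<Sum>B\<in>P. ennreal \<bar>\<nu> B\<bar>)"

text \<open>Packings of two disjoint sets unite to a packing of the union; the two suprema are then
  taken one after the other.\<close>

lemma total_variation_Un_ge: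
  assumes \<nu>: "locally_finite_signed_measure S \<nu>" and AB: "A \<inter> B = {}"
  shows "total_variation S \<nu> A + total_variation S \<nu> B \<le> total_variation S \<nu> (A \<union> B)"
proof -
  let ?s = "\<lambda>P. \<Sum>B\<in>P. ennreal \<bar>\<nu> B\<bar>"
  have *: "?s P + ?s Q \<le> total_variation S \<nu> (A \<union> B)"
    if P: "P \<in> disjoint_packings S A" and Q: "Q \<in> disjoint_packings S B" for P Q
  proof -
    have sub: "X \<subseteq> A" if "X \<in> P" for X
      using P that by (auto simp: disjoint_packings_def)
    have sub': "X \<subseteq> B" if "X \<in> Q" for X
      using Q that by (auto simp: disjoint_packings_def)
    \<comment> \<open>The packings can share only the empty set, of value 0, so the sum over their
      union loses nothing.\<close>
    have "X = {}" if "X \<in> P \<inter> Q" for X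
      using sub[of X] sub'[of X] that AB by auto
    then have "\<forall>X\<in>P \<inter> Q. ennreal \<bar>\<nu> X\<bar> = 0"
      using \<nu> by force
    then have "?s P + ?s Q = ?s (P \<union> Q)"
      using P Q by (intro sum.union_inter_neutral[symmetric]) (auto simp: disjoint_packings_def)
    also have "P \<union> Q \<in> disjoint_packings S (A \<union> B)"
      using P Q AB unfolding disjoint_packings_def by (blast intro: disjoint_union)
    then have "?s (P \<union> Q) \<le> total_variation S \<nu> (A \<union> B)"
      unfolding total_variation_def by (rule SUP_upper)
    finally show ?thesis .
  qed
  have ne: "disjoint_packings S X \<noteq> {}" for X
    by (auto simp: disjoint_packings_def intro!: exI[of _ "{}"])
  have "?s P + total_variation S \<nu> B \<le> total_variation S \<nu> (A \<union> B)"
    if P: "P \<in> disjoint_packings S A" for P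
    unfolding total_variation_def[of S \<nu> B]
    by (subst ennreal_SUP_add_right[OF ne]) (intro SUP_least *[OF P])
  then show ?thesis
    unfolding total_variation_def[of S \<nu> A]
    by (subst ennreal_SUP_add_left[OF ne, symmetric]) (intro SUP_least)
qed

text \<open>One half of countable additivity: each partial sum is at most the variation of a finite
  union, by induction, and hence at most that of the whole union.\<close>

lemma total_variation_suminf_ge:
  assumes \<nu>: "locally_finite_signed_measure S \<nu>" and A: "disjoint_family A"
  shows "(\<Sum>i. total_variation S \<nu> (A i)) \<le> total_variation S \<nu> (\<Union>i. A i)"
proof (rule suminf_le_const)
  have mono: "total_variation S \<nu> B \<le> total_variation S \<nu> C" if "B \<subseteq> C" for B C
    unfolding total_variation_def using that
    by (intro SUP_subset_mono) (auto simp: disjoint_packings_def)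
  fix n
  have "(\<Sum>i<n. total_variation S \<nu> (A i)) \<le> total_variation S \<nu> (\<Union>i<n. A i)"
  proof (induction n)
    case (Suc n)
    have "A i \<inter> A n = {}" if "i < n" for i
      using A that by (simp add: disjoint_family_on_def)
    then have "(\<Union>i<n. A i) \<inter> A n = {}"
      by blast
    then have "total_variation S \<nu> (\<Union>i<n. A i) + total_variation S \<nu> (A n)
        \<le> total_variation S \<nu> (\<Union>i<Suc n. A i)"
      using total_variation_Un_ge[OF \<nu>, of "\<Union>i<n. A i" "A n"] by (simp add: lessThan_Suc Un_commute)
    with Suc show ?case
      by (simp only: sum.lessThan_Suc) (meson add_right_mono order_trans)
  qed simp
  also have "\<dots> \<le> total_variation S \<nu> (\<Union>i. A i)"
    by (intro mono) auto
  finally show "(\<Sum>i<n. total_variation S \<nu> (A i)) \<le> total_variation S \<nu> (\<Union>i. A i)" .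
qed simp

text \<open>The other half: each member \<open>B\<close> of a packing is cut into the pieces
  \<open>B \<inter> A i\<close>, and for fixed \<open>i\<close> these pieces form a packing of
  \<open>A i\<close>.\<close>

lemma total_variation_suminf_le:
  assumes \<nu>: "locally_finite_signed_measure S \<nu>"
    and A: "disjoint_family A" "\<And>i. A i \<in> sets (restrict_space borel S)"
    and S: "S \<in> sets borel"
  shows "total_variation S \<nu> (\<Union>i. A i) \<le> (\<Sum>i. total_variation S \<nu> (A i))"
  unfolding total_variation_def[of S \<nu> "\<Union>i. A i"]
proof (rule SUP_least)
  fix P assume P: "P \<in> disjoint_packings S (\<Union>i. A i)"
  have A_borel: "A i \<in> sets borel" for i
    using A(2)[of i] S by (auto simp: sets_restrict_space)
  have loc: "B \<inter> A i \<in> local_borel_sets S" if "B \<in> P" for B i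
  proof -
    have B: "B \<in> local_borel_sets S"
      using P that by (auto simp: disjoint_packings_def)
    then show ?thesis
      by (rule local_borel_sets_mono) (use local_borel_sets_borel[OF B] A_borel[of i] in auto)
  qed
  have "(\<Sum>B\<in>P. ennreal \<bar>\<nu> B\<bar>) \<le> (\<Sum>B\<in>P. \<Sum>i. ennreal \<bar>\<nu> (B \<inter> A i)\<bar>)"
  proof (rule sum_mono)
    fix B assume B: "B \<in> P"
    then have U: "(\<Union>i. B \<inter> A i) = B" and BL: "B \<in> local_borel_sets S"
      using P by (auto simp: disjoint_packings_def)
    have "disjoint_family (\<lambda>i. B \<inter> A i)"
      using A(1) by (auto simp: disjoint_family_on_def)
    moreover have "range (\<lambda>i. B \<inter> A i) \<subseteq> local_borel_sets S"
      using loc[OF B] by blast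
    ultimately show "ennreal \<bar>\<nu> B\<bar> \<le> (\<Sum>i. ennreal \<bar>\<nu> (B \<inter> A i)\<bar>)"
      using lfsm_abs_le_suminf[OF \<nu>, of "\<lambda>i. B \<inter> A i"] BL unfolding U by blast
  qed
  also have "\<dots> = (\<Sum>i. \<Sum>B\<in>P. ennreal \<bar>\<nu> (B \<inter> A i)\<bar>)"
    by (rule suminf_sum[symmetric]) simp
  also have "\<dots> \<le> (\<Sum>i. total_variation S \<nu> (A i))"
  proof (intro suminf_le)
    fix i
    have dis: "(B \<inter> A i) \<inter> (C \<inter> A i) = {}" if "B \<in> P" "C \<in> P" "B \<noteq> C" for B C
      using P that by (auto simp: disjoint_packings_def disjoint_def)
    \<comment> \<open>Distinct members with the same trace on \<open>A i\<close> have empty trace,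
      so collapsing them in the image drops only zeros.\<close>
    have "(\<Sum>B\<in>P. ennreal \<bar>\<nu> (B \<inter> A i)\<bar>) = (\<Sum>C\<in>(\<lambda>B. B \<inter> A i) ` P. ennreal \<bar>\<nu> C\<bar>)"
    proof (subst sum.reindex_nontrivial)
      show "ennreal \<bar>\<nu> (B \<inter> A i)\<bar> = 0"
        if "B \<in> P" "C \<in> P" "B \<noteq> C" "B \<inter> A i = C \<inter> A i" for B C
        using dis[OF that(1-3)] that(4) \<nu> by simp
    qed (use P in \<open>auto simp: disjoint_packings_def\<close>)
    also have "disjoint ((\<lambda>B. B \<inter> A i) ` P)"
      using dis by (intro pairwise_imageI) (simp add: disjnt_def)
    then have "(\<lambda>B. B \<inter> A i) ` P \<in> disjoint_packings S (A i)"
      using P loc by (auto simp: disjoint_packings_def)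
    then have "(\<Sum>C\<in>(\<lambda>B. B \<inter> A i) ` P. ennreal \<bar>\<nu> C\<bar>) \<le> total_variation S \<nu> (A i)"
      unfolding total_variation_def by (rule SUP_upper)
    finally show "(\<Sum>B\<in>P. ennreal \<bar>\<nu> (B \<inter> A i)\<bar>) \<le> total_variation S \<nu> (A i)" .
  qed auto
  finally show "(\<Sum>B\<in>P. ennreal \<bar>\<nu> B\<bar>) \<le> (\<Sum>i. total_variation S \<nu> (A i))" .
qed

lemma sets_variation_measure [simp, measurable_cong]:
  "sets (variation_measure S \<nu>) = sets (restrict_space borel S)"
proof -
  have "sets (restrict_space borel S) \<subseteq> Pow S"
    by (auto simp: sets_restrict_space)
  then show ?thesis
    using sets.sigma_sets_eq[of "restrict_space borel S"]
    by (simp add: variation_measure_def space_restrict_space)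
qed

text \<open>\<open>measure_of\<close> yields the null measure unless its set function is positive
  and countably additive; both are verified here.\<close>

lemma emeasure_variation_measure:
  assumes \<nu>: "locally_finite_signed_measure S \<nu>" and S: "S \<in> sets borel"
    and A: "A \<in> sets (restrict_space borel S)"
  shows "emeasure (variation_measure S \<nu>) A = total_variation S \<nu> A"
proof -
  have V: "variation_measure S \<nu> = measure_of S (sets (restrict_space borel S)) (total_variation S \<nu>)"
    by (simp add: variation_measure_def total_variation_def [abs_def] disjoint_packings_def)
  show ?thesis
    unfolding V
  proof (rule emeasure_measure_of_sigma[OF _ _ _ A])
    show "sigma_algebra S (sets (restrict_space borel S))"
      using sets.sigma_algebra_axioms[of "restrict_space borel S"] by (simp add: space_restrict_space)
    have "(\<Sum>B\<in>P. ennreal \<bar>\<nu> B\<bar>) \<le> 0" if "P \<in> disjoint_packings S {}" for P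
      using that \<nu> by (intro sum_nonpos) (auto simp: disjoint_packings_def)
    then have "total_variation S \<nu> {} \<le> 0"
      unfolding total_variation_def by (rule SUP_least)
    then show "positive (sets (restrict_space borel S)) (total_variation S \<nu>)"
      by (simp add: positive_def)
    show "countably_additive (sets (restrict_space borel S)) (total_variation S \<nu>)"
      by (intro countably_additiveI antisym total_variation_suminf_le total_variation_suminf_ge \<nu> S) auto
  qed
qed

text \<open>The family \<open>{A}\<close> is itself a packing of \<open>A\<close>.\<close>

lemma abs_le_variation_measure:
  assumes \<nu>: "locally_finite_signed_measure S \<nu>" and S: "S \<in> sets borel"
    and A: "A \<in> local_borel_sets S"
  shows "ennreal \<bar>\<nu> A\<bar> \<le> emeasure (variation_measure S \<nu>) A"
proof -
  have "A \<in> sets (restrict_space borel S)"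
    using A S local_borel_sets_borel local_borel_sets_subset by (auto simp: sets_restrict_space_iff)
  moreover have "(\<Sum>B\<in>{A}. ennreal \<bar>\<nu> B\<bar>) \<le> total_variation S \<nu> A"
    unfolding total_variation_def using A
    by (intro SUP_upper) (auto simp: disjoint_packings_def)
  ultimately show ?thesis
    by (simp add: emeasure_variation_measure[OF \<nu> S])
qed

section \<open>Integrability near the origin\<close>

text \<open>A Markov inequality: the integrand exceeds \<open>x\<close> on
  \<open>{x<..u}\<close>.\<close>

lemma times_emeasure_tail_le:
  fixes M :: "real measure"
  assumes [measurable_cong]: "sets M = sets borel" and x: "0 \<le> x"
  shows "ennreal x * emeasure M {x<..u} \<le> (\<integral>\<^sup>+y\<in>{0<..u}. ennreal y \<partial>M)"
proof -
  have "ennreal x * emeasure M {x<..u} = (\<integral>\<^sup>+y. ennreal x * indicator {x<..u} y \<partial>M)"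
    by (intro nn_integral_cmult_indicator[symmetric]) simp
  also have "\<dots> \<le> (\<integral>\<^sup>+y\<in>{0<..u}. ennreal y \<partial>M)"
    using x by (intro nn_integral_mono) (auto simp: indicator_def intro!: ennreal_leI)
  finally show ?thesis .
qed

text \<open>Tonelli is applied to the finite measure \<open>y dM\<close> on \<open>(0, u]\<close> because \<open>M\<close> itself need not be
  sigma-finite.\<close>

lemma set_integrable_tail:
  fixes M :: "real measure"
  assumes sets [measurable_cong]: "sets M = sets borel"
    and fin: "(\<integral>\<^sup>+y\<in>{0<..u}. ennreal y \<partial>M) < \<infinity>"
  shows "set_integrable lborel {0<..u} (\<lambda>x. measure M {x<..u})"
proof -
  define W where "W = density M (\<lambda>y. ennreal y * indicator {0<..u} y)"
  have [measurable_cong]: "sets W = sets borel"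
    by (simp add: W_def sets)
  interpret W: finite_measure W
    using fin by (intro finite_measureI) (simp add: W_def emeasure_density sets_eq_imp_space_eq[OF sets])
  interpret pair_sigma_finite lborel W ..
  \<comment> \<open>The factor \<open>1 / y\<close> cancels the density of \<open>W\<close>, so
    integrating in \<open>y\<close> gives the tail of \<open>M\<close>; integrating in
    \<open>x\<close> gives at most \<open>y * (1 / y) = 1\<close>.\<close>
  define k where "k x y = ennreal (1 / y) * (if 0 < x \<and> x < y \<and> y \<le> u then 1 else 0)" for x y :: real
  have k_measurable [measurable]: "case_prod k \<in> borel_measurable (lborel \<Otimes>\<^sub>M W)"
    unfolding k_def by measurable
  have tail: "(\<integral>\<^sup>+y. k x y \<partial>W) = emeasure M {x<..u} * indicator {0<..u} x" for x
  proof -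
    have "(\<integral>\<^sup>+y. k x y \<partial>W) = (\<integral>\<^sup>+y. ennreal y * indicator {0<..u} y * k x y \<partial>M)"
      unfolding W_def k_def by (intro nn_integral_density) measurable
    also have "\<dots> = (\<integral>\<^sup>+y. indicator {0<..u} x * indicator {x<..u} y \<partial>M)"
      by (intro nn_integral_cong) (auto simp: k_def indicator_def simp flip: ennreal_mult')
    also have "\<dots> = emeasure M {x<..u} * indicator {0<..u} x"
      by (subst nn_integral_cmult_indicator) (auto simp: sets mult.commute)
    finally show ?thesis .
  qed
  have "(\<lambda>x. \<integral>\<^sup>+y. k x y \<partial>W) \<in> borel_measurable lborel"
    by measurable
  then have tail_measurable: "(\<lambda>x. emeasure M {x<..u} * indicator {0<..u} x) \<in> borel_measurable lborel"
    by (simp only: tail)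
  have "(\<integral>\<^sup>+x. \<integral>\<^sup>+y. k x y \<partial>W \<partial>lborel) = (\<integral>\<^sup>+y. \<integral>\<^sup>+x. k x y \<partial>lborel \<partial>W)"
    by (rule Fubini'[symmetric]) measurable
  also have "\<dots> \<le> (\<integral>\<^sup>+y. 1 \<partial>W)"
  proof (intro nn_integral_mono)
    fix y
    have "(\<integral>\<^sup>+x. k x y \<partial>lborel) \<le> (\<integral>\<^sup>+x. ennreal (1 / y) * indicator {0<..<y} x \<partial>lborel)"
      by (intro nn_integral_mono) (auto simp: k_def indicator_def)
    also have "\<dots> \<le> 1"
      by (cases "0 < y") (auto simp: nn_integral_cmult_indicator simp flip: ennreal_mult')
    finally show "(\<integral>\<^sup>+x. k x y \<partial>lborel) \<le> 1" .
  qed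
  also have "\<dots> < \<infinity>"
    by (simp flip: less_top)
  finally have fin': "(\<integral>\<^sup>+x. emeasure M {x<..u} * indicator {0<..u} x \<partial>lborel) < \<infinity>"
    by (simp only: tail)
  \<comment> \<open>Both \<open>measure\<close> and \<open>enn2real\<close> send an infinite tail to
    0, so no finiteness of the tail is presupposed.\<close>
  have eq: "indicator {0<..u} x *\<^sub>R measure M {x<..u}
      = enn2real (emeasure M {x<..u} * indicator {0<..u} x)" for x
    by (simp add: measure_def indicator_def)
  show ?thesis
    unfolding set_integrable_def eq
  proof (rule integrableI_bounded)
    show "(\<lambda>x. enn2real (emeasure M {x<..u} * indicator {0<..u} x)) \<in> borel_measurable lborel"
      using tail_measurable by measurable
    have "(\<integral>\<^sup>+x. ennreal (norm (enn2real (emeasure M {x<..u} * indicator {0<..u} x))) \<partial>lborel)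
        \<le> (\<integral>\<^sup>+x. emeasure M {x<..u} * indicator {0<..u} x \<partial>lborel)"
      by (intro nn_integral_mono) (simp add: ennreal_enn2real_if)
    also note fin'
    finally show "(\<integral>\<^sup>+x. ennreal (norm (enn2real (emeasure M {x<..u} * indicator {0<..u} x))) \<partial>lborel) < \<infinity>" .
  qed
qed

section \<open>Regularity of differences of convex functions\<close>

lemma diff_convex_on_set_measurable_right_deriv:
  assumes g: "diff_convex_on {a<..<b} g" and S: "S \<subseteq> {a<..<b}" "S \<in> sets borel"
  shows "set_borel_measurable lborel S (right_deriv g)"
proof -
  obtain f h where f: "convex_on {a<..<b} f" and h: "convex_on {a<..<b} h"
    and eq: "\<And>x. x \<in> {a<..<b} \<Longrightarrow> right_deriv g x = right_deriv f x - right_deriv h x"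
    by (rule diff_convex_onE[OF g]) (rule that)
  \<comment> \<open>Monotone functions are Borel measurable.\<close>
  have "right_deriv \<phi> \<in> borel_measurable (restrict_space lborel S)" if "convex_on {a<..<b} \<phi>" for \<phi>
    using borel_measurable_mono_on_fnc[OF mono_on_subset[OF convex_on_right_deriv_mono[OF that] S(1)]]
    by (simp cong: measurable_cong_sets sets_restrict_space_cong)
  from this[OF f] this[OF h]
  have "(\<lambda>x. right_deriv f x - right_deriv h x) \<in> borel_measurable (restrict_space lborel S)"
    by measurable
  also have "?this \<longleftrightarrow> right_deriv g \<in> borel_measurable (restrict_space lborel S)"
    using eq S by (intro measurable_cong) (auto simp: space_restrict_space)
  finally show ?thesis
    using S by (simp add: set_borel_measurable_def borel_measurable_restrict_space_iff)
qed

lemma diff_convex_on_right_deriv_has_integral: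
  assumes g: "diff_convex_on {a<..<b} g" and xy: "a < x" "x \<le> y" "y < b"
  shows "(right_deriv g has_integral g y - g x) {x..y}"
proof -
  obtain f h where f: "convex_on {a<..<b} f" and h: "convex_on {a<..<b} h"
    and eq: "\<And>x. x \<in> {a<..<b} \<Longrightarrow> g x = f x - h x"
    and eq': "\<And>x. x \<in> {a<..<b} \<Longrightarrow> right_deriv g x = right_deriv f x - right_deriv h x"
    by (rule diff_convex_onE[OF g]) (rule that)
  have "((\<lambda>t. right_deriv f t - right_deriv h t) has_integral (f y - f x) - (h y - h x)) {x..y}"
    by (intro has_integral_diff convex_on_right_deriv_has_integral[OF f]
        convex_on_right_deriv_has_integral[OF h] xy)
  moreover have "(f y - f x) - (h y - h x) = g y - g x"
    using eq[of x] eq[of y] xy by simp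
  ultimately show ?thesis
    using eq' xy by (subst has_integral_cong[where g = "\<lambda>t. right_deriv f t - right_deriv h t"]) auto
qed

text \<open>The monotone right derivatives of the convex parts have countably many discontinuities;
  elsewhere both parts are differentiable.\<close>

lemma diff_convex_on_has_real_derivative:
  assumes g: "diff_convex_on {a<..<b} g"
  obtains X where "countable X"
    and "\<And>x. x \<in> {a<..<b} - X \<Longrightarrow> (g has_real_derivative right_deriv g x) (at x)"
proof -
  obtain f h where f: "convex_on {a<..<b} f" and h: "convex_on {a<..<b} h"
    and eq: "\<And>x. x \<in> {a<..<b} \<Longrightarrow> g x = f x - h x"
    and eq': "\<And>x. x \<in> {a<..<b} \<Longrightarrow> right_deriv g x = right_deriv f x - right_deriv h x"
    by (rule diff_convex_onE[OF g]) (rule that)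
  define X where "X = {x \<in> {a<..<b}. \<not> isCont (right_deriv f) x} \<union> {x \<in> {a<..<b}. \<not> isCont (right_deriv h) x}"
  show ?thesis
  proof
    show "countable X"
      unfolding X_def using f h
      by (intro countable_Un mono_on_ctble_discont_open convex_on_right_deriv_mono) auto
    fix x assume "x \<in> {a<..<b} - X"
    then have x: "x \<in> {a<..<b}" "isCont (right_deriv f) x" "isCont (right_deriv h) x"
      by (auto simp: X_def)
    have "((\<lambda>t. f t - h t) has_real_derivative right_deriv f x - right_deriv h x) (at x)"
      by (intro derivative_intros convex_on_has_real_derivative[OF f] convex_on_has_real_derivative[OF h] x)
    then show "(g has_real_derivative right_deriv g x) (at x)"
      unfolding eq'[OF x(1)]
      by (rule has_field_derivative_transform_within_open[of _ _ _ "{a<..<b}"]) (use x eq in auto)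
  qed
qed

text \<open>The increment of the right derivative is the signed measure of \<open>{x<..u}\<close>,
  bounded by the variation. Finiteness is assumed because \<open>measure\<close> gives 0 on a set of
  infinite variation.\<close>

lemma right_deriv_tail_bound:
  assumes a: "0 < a" and g: "diff_convex_on {0<..<a} g"
    and u: "u \<in> {0<..<a}" and x: "0 < x" "x \<le> u"
    and fin: "emeasure (variation_measure {0<..<a} (second_deriv_measure a g)) {x<..u} < \<infinity>"
  shows "\<bar>right_deriv g x\<bar> \<le> \<bar>right_deriv g u\<bar>
    + measure (variation_measure {0<..<a} (second_deriv_measure a g)) {x<..u}"
proof (cases "x = u")
  case False
  let ?\<nu> = "second_deriv_measure a g"
  note \<nu> = second_deriv_measure[OF a g]
  have "{x<..u} \<in> local_borel_sets {0<..<a}"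
    unfolding local_borel_sets_iff[OF a] using x u False
    by (intro conjI exI[of _ x] exI[of _ u]) auto
  then have "ennreal \<bar>?\<nu> {x<..u}\<bar> \<le> emeasure (variation_measure {0<..<a} ?\<nu>) {x<..u}"
    by (intro abs_le_variation_measure \<nu>) auto
  also have "\<dots> = ennreal (measure (variation_measure {0<..<a} ?\<nu>) {x<..u})"
    using fin by (intro emeasure_eq_ennreal_measure) auto
  finally have "\<bar>?\<nu> {x<..u}\<bar> \<le> measure (variation_measure {0<..<a} ?\<nu>) {x<..u}"
    by (simp add: ennreal_le_iff)
  with \<nu>(2)[of x u] x u False show ?thesis
    by auto
qed simp

theorem lemma5p1:
  fixes a u :: real and g g' :: "real \<Rightarrow> real"
  assumes "0 < a"
    and "diff_convex_on {0<..<a} g"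
    and "u \<in> {0<..<a}"
    and "(\<integral>\<^sup>+x\<in>{0<..u}. ennreal x \<partial>variation_measure {0<..<a} (second_deriv_measure a g)) < \<infinity>"
    and "\<And>x D. x \<in> {0<..<a} \<Longrightarrow> (g has_real_derivative D) (at x) \<Longrightarrow> g' x = D"
  shows "(\<exists>L. (g \<longlongrightarrow> L) (at_right 0)) \<and>
         set_integrable lborel {0<..u} (\<lambda>x. x * (g' x)\<^sup>2)"
proof -
  define V where "V = variation_measure {0<..<a} (second_deriv_measure a g)"
  \<comment> \<open>\<open>V\<close> lives on the Borel sets of \<open>(0, a)\<close>; its image
    under the identity is a measure on all Borel sets of the line, as the tail lemmas
    require.\<close>
  define M where "M = distr V borel (\<lambda>x. x)"
  define C where "C = (\<integral>\<^sup>+y\<in>{0<..u}. ennreal y \<partial>M)"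
  define G where "G x = measure V {x<..u}" for x
  let ?d = "right_deriv g"
  note g = assms(2) and u = assms(3)
  have sets_V: "sets V = sets (restrict_space borel {0<..<a})"
    by (simp add: V_def)
  have space_V: "space V = {0<..<a}"
    using sets_eq_imp_space_eq[OF sets_V] by (simp add: space_restrict_space)
  have id_measurable: "(\<lambda>x. x) \<in> V \<rightarrow>\<^sub>M borel"
    by (simp add: measurable_cong_sets[OF sets_V refl] measurable_restrict_space1)
  have sets_M: "sets M = sets borel"
    by (simp add: M_def)
  have C: "C < \<infinity>"
    using assms(4) unfolding C_def M_def V_def[symmetric]
    by (subst nn_integral_distr[OF id_measurable]) auto
  have M_V: "emeasure M {x<..u} = emeasure V {x<..u}" if "0 < x" for x
  proof -
    have "{x<..u} \<inter> {0<..<a} = {x<..u}"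
      using that u by auto
    then show ?thesis
      by (simp add: M_def emeasure_distr[OF id_measurable] space_V)
  qed
  have tail_le: "ennreal x * emeasure V {x<..u} \<le> C" if "0 < x" for x
    using times_emeasure_tail_le[OF sets_M, of x u] that M_V[of x] by (simp add: C_def)
  \<comment> \<open>Dividing by \<open>x > 0\<close> makes each tail finite, although
    \<open>V\<close> may give \<open>(0, u]\<close> infinite mass.\<close>
  have tail_fin: "emeasure V {x<..u} < \<infinity>" if "0 < x" for x
  proof -
    have "ennreal x * emeasure V {x<..u} < \<infinity>"
      using tail_le[OF that] C by (rule order.strict_trans1)
    then show ?thesis
      using that by (auto simp: ennreal_mult_less_top)
  qed
  have G_le: "x * G x \<le> enn2real C" if "0 < x" for x
  proof -
    have "ennreal (x * G x) \<le> C"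
      using tail_le[OF that] tail_fin[OF that] that
      by (simp add: G_def ennreal_mult emeasure_eq_ennreal_measure less_top)
    then have "enn2real (ennreal (x * G x)) \<le> enn2real C"
      using C by (intro enn2real_mono) auto
    then show ?thesis
      using that by (simp add: G_def)
  qed
  have d_le: "\<bar>?d x\<bar> \<le> \<bar>?d u\<bar> + G x" if "x \<in> {0<..u}" for x
    using right_deriv_tail_bound[OF assms(1) g u, of x] tail_fin[of x] that
    by (simp add: G_def V_def)
  have "set_integrable lborel {0<..u} (\<lambda>x. measure M {x<..u})"
    using C unfolding C_def by (intro set_integrable_tail sets_M)
  also have "?this \<longleftrightarrow> set_integrable lborel {0<..u} G"
    by (intro set_integrable_cong) (auto simp: G_def measure_def M_V)
  finally have G_int: "set_integrable lborel {0<..u} G" .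
  have const_int: "set_integrable lborel {0<..u} (\<lambda>_. c)" for c :: real
    unfolding set_integrable_def using u by simp
  have d_meas: "set_borel_measurable lborel {0<..u} ?d"
    using u by (intro diff_convex_on_set_measurable_right_deriv[OF g]) auto
  have d_int: "set_integrable lborel {0<..u} ?d"
  proof (rule set_integrable_bound)
    show "set_integrable lborel {0<..u} (\<lambda>x. \<bar>?d u\<bar> + G x)"
      by (intro set_integral_add const_int G_int)
    show "AE x in lborel. x \<in> {0<..u} \<longrightarrow> norm (?d x) \<le> norm (\<bar>?d u\<bar> + G x)"
      using d_le by (intro AE_I2) (force simp: G_def)
  qed (rule d_meas)
  have d2_int: "set_integrable lborel {0<..u} (\<lambda>x. x * (?d x)\<^sup>2)"
  proof (rule set_integrable_bound)
    \<comment> \<open>Compared with the pointwise bound, \<open>x\<close> is replaced by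
      \<open>u\<close> in the first term, which becomes constant.\<close>
    show "set_integrable lborel {0<..u} (\<lambda>x. 2 * u * (?d u)\<^sup>2 + 2 * enn2real C * G x)"
      by (intro set_integral_add const_int set_integrable_mult_right G_int)
    have "x * (?d x)\<^sup>2 \<le> 2 * u * (?d u)\<^sup>2 + 2 * enn2real C * G x" if x: "x \<in> {0<..u}" for x
    proof -
      have "(?d x)\<^sup>2 \<le> (\<bar>?d u\<bar> + G x)\<^sup>2"
        using power_mono[OF d_le[OF x], of 2] by simp
      also have "\<dots> \<le> 2 * (?d u)\<^sup>2 + 2 * (G x)\<^sup>2"
        using sum_squares_bound[of "\<bar>?d u\<bar>" "G x"] by (simp add: power2_sum)
      finally have "x * (?d x)\<^sup>2 \<le> x * (2 * (?d u)\<^sup>2 + 2 * (G x)\<^sup>2)"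
        using x by (intro mult_left_mono) auto
      also have "\<dots> = x * (2 * (?d u)\<^sup>2) + 2 * (x * G x) * G x"
        by (simp add: algebra_simps power2_eq_square)
      also have "\<dots> \<le> u * (2 * (?d u)\<^sup>2) + 2 * enn2real C * G x"
        using x G_le[of x] by (intro add_mono mult_right_mono) (auto simp: G_def)
      finally show ?thesis by simp
    qed
    then show "AE x in lborel. x \<in> {0<..u} \<longrightarrow>
        norm (x * (?d x)\<^sup>2) \<le> norm (2 * u * (?d u)\<^sup>2 + 2 * enn2real C * G x)"
      by (intro AE_I2) force
    \<comment> \<open>The indicator is idempotent and can be moved out of the square.\<close>
    have "(\<lambda>x. x * (indicator {0<..u} x *\<^sub>R ?d x)\<^sup>2) \<in> borel_measurable lborel"
      using d_meas unfolding set_borel_measurable_def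
      by (intro borel_measurable_times borel_measurable_power) auto
    then show "set_borel_measurable lborel {0<..u} (\<lambda>x. x * (?d x)\<^sup>2)"
      unfolding set_borel_measurable_def
      by (rule measurable_cong[THEN iffD1, rotated]) (simp add: indicator_def)
  qed
  have "\<exists>L. (g \<longlongrightarrow> L) (at_right 0)"
  proof -
    have "?d integrable_on {0<..u}"
      using d_int by (rule set_borel_integral_eq_integral)
    \<comment> \<open>Adding the null set \<open>{0}\<close> makes the interval closed, so
      continuity of the indefinite integral at its left end yields the limit.\<close>
    then have "?d integrable_on {0..u}"
      by (rule integrable_spike_set) (rule negligible_subset[of "{0}"], auto)+
    then have "continuous_on {0..u} (\<lambda>x. integral {x..u} ?d)"
      by (rule indefinite_integral_continuous_1')
    then have "((\<lambda>x. integral {x..u} ?d) \<longlongrightarrow> integral {0..u} ?d) (at 0 within {0..u})"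
      using u by (auto simp: continuous_on_def)
    then have "((\<lambda>x. g u - integral {x..u} ?d) \<longlongrightarrow> g u - integral {0..u} ?d) (at_right 0)"
      using u by (intro tendsto_intros) (simp add: at_within_Icc_at_right)
    moreover have "\<forall>\<^sub>F x in at_right 0. g u - integral {x..u} ?d = g x"
    proof (rule eventually_at_rightI[of 0 u])
      fix x assume "x \<in> {0<..<u}"
      then have "integral {x..u} ?d = g u - g x"
        using u by (intro integral_unique diff_convex_on_right_deriv_has_integral[OF g]) auto
      then show "g u - integral {x..u} ?d = g x" by simp
    qed (use u in simp)
    ultimately show ?thesis
      using Lim_transform_eventually by blast
  qed
  moreover have "set_integrable lborel {0<..u} (\<lambda>x. x * (g' x)\<^sup>2)"
  proof -
    obtain X where X: "countable X"
      "\<And>x. x \<in> {0<..<a} - X \<Longrightarrow> (g has_real_derivative ?d x) (at x)"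
      by (rule diff_convex_on_has_real_derivative[OF g]) (rule that)
    have eq: "g' x = ?d x" if "x \<in> {0<..u}" "x \<notin> X" for x
      using that u X(2)[of x] by (intro assms(5)) auto
    \<comment> \<open>Changing a function on a countable set preserves both measurability and
      integrability, so the values of \<open>g'\<close> on \<open>X\<close> may be
      arbitrary.\<close>
    have "set_integrable lborel {0<..u} (\<lambda>x. x * (?d x)\<^sup>2)
        \<longleftrightarrow> set_integrable lborel {0<..u} (\<lambda>x. x * (g' x)\<^sup>2)"
      unfolding set_integrable_def
      by (rule integrable_discrete_difference[OF X(1)]) (auto simp: eq indicator_def)
    with d2_int show ?thesis by simp
  qed
  ultimately show ?thesis by blast
qed

end
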